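(* For every integer $n\ge 1$, $$\sum_{i=0}^{n-1}\left[\binom{6n}{6i+1}+\binom{6n}{6i+5}+\binom{6n-2}{6i+1}+\binom{6n-2}{6i+3}\right]\equiv \binom{6}{1}+ \binom{6}{5} +\binom{4}{1}+\binom{4}{3}= 20 \pmod{42}.$$
   Context: Here $\binom{a}{b}$ denotes the usual binomial coefficient for non-negative integers $a,b$. *)

theory Defs
  imports "HOL-Number_Theory.Cong"
begin

end

theory Submission
  imports Defs
begin

text \<open>
  Sums of binomial coefficients over a residue class modulo 6 satisfy the cyclic Pascal rule.
  Six steps of this rule form a circulant map on the six class sums, and modulo 42 this map
  fixes the vector \<open>(1, 4, 6, 4, 1, 0)\<close> of the fourth row, hence the vector is the same in
  all rows \<open>6 j + 4\<close>. Two further steps give the row \<open>6 n\<close>.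
\<close>

text \<open>For \<open>m < 6 * N\<close> the cutoff \<open>N\<close> drops only zero terms, so this
  is then the full sum over the class of \<open>r\<close>. A cutoff independent of \<open>m\<close>
  lets one \<open>N\<close> serve all rows of the recurrence.\<close>

definition class_sum :: "nat \<Rightarrow> nat \<Rightarrow> nat \<Rightarrow> nat" where
  "class_sum N m r = (\<Sum>i<N. m choose (6 * i + r))"

lemma class_sum_Suc_Suc: "class_sum N (Suc m) (Suc r) = class_sum N m r + class_sum N m (Suc r)"
  by (simp add: class_sum_def sum.distrib)

text \<open>The bound on \<open>m\<close> makes the wrap-around term \<open>m choose (6 * N - 1)\<close> vanish.\<close>

lemma class_sum_Suc_0:
  assumes "m + 1 < 6 * N"
  shows "class_sum N (Suc m) 0 = class_sum N m 5 + class_sum N m 0"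
proof -
  obtain M where N: "N = Suc M"
    using assms by (cases N) auto
  have shift: "Suc m choose (6 * Suc i) = (m choose (6 * i + 5)) + (m choose (6 * Suc i))" for i
  proof -
    have "6 * Suc i = Suc (6 * i + 5)"
      by simp
    then show ?thesis
      by (metis binomial_Suc_Suc)
  qed
  have "class_sum N (Suc m) 0 = 1 + (\<Sum>i<M. Suc m choose (6 * Suc i))"
    unfolding class_sum_def N by (subst sum.lessThan_Suc_shift) simp
  also have "\<dots> = (\<Sum>i<M. m choose (6 * i + 5)) + (1 + (\<Sum>i<M. m choose (6 * Suc i)))"
    unfolding shift sum.distrib by simp
  also have "1 + (\<Sum>i<M. m choose (6 * Suc i)) = class_sum N m 0"
    unfolding class_sum_def N by (subst sum.lessThan_Suc_shift) simp
  also have "(\<Sum>i<M. m choose (6 * i + 5)) = class_sum N m 5"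
    using assms unfolding class_sum_def N by (simp add: binomial_eq_0)
  finally show ?thesis .
qed

lemma class_sum_step:
  assumes "m + 1 < 6 * N"
  shows "class_sum N (Suc m) 0 = class_sum N m 5 + class_sum N m 0"
    and "class_sum N (Suc m) 1 = class_sum N m 0 + class_sum N m 1"
    and "class_sum N (Suc m) 2 = class_sum N m 1 + class_sum N m 2"
    and "class_sum N (Suc m) 3 = class_sum N m 2 + class_sum N m 3"
    and "class_sum N (Suc m) 4 = class_sum N m 3 + class_sum N m 4"
    and "class_sum N (Suc m) 5 = class_sum N m 4 + class_sum N m 5"
  using class_sum_Suc_0[OF assms] class_sum_Suc_Suc[of N m 0] class_sum_Suc_Suc[of N m 1]
    class_sum_Suc_Suc[of N m 2] class_sum_Suc_Suc[of N m 3] class_sum_Suc_Suc[of N m 4]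
  by (simp_all add: eval_nat_numeral)

lemma class_sum_row_0:
  assumes "N \<ge> 1"
  shows "class_sum N 0 r = (if r = 0 then 1 else 0)"
proof -
  obtain M where N: "N = Suc M"
    using assms by (cases N) auto
  show ?thesis
    unfolding class_sum_def N by (subst sum.lessThan_Suc_shift) (auto simp: binomial_eq_0)
qed

text \<open>With row \<open>m\<close> encoded as a polynomial modulo \<open>t^6 - 1\<close>, a
  Pascal step is multiplication by \<open>1 + t\<close>; the coefficients 1, 3, 3, 1 are those of
  \<open>(1 + t)^3\<close>.\<close>

lemma class_sum_3_steps:
  assumes "m + 3 < 6 * N"
  defines "x \<equiv> class_sum N m" and "y \<equiv> class_sum N (m + 3)"
  shows "y 0 = x 0 + 3 * x 5 + 3 * x 4 + x 3"
    and "y 1 = x 1 + 3 * x 0 + 3 * x 5 + x 4"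
    and "y 2 = x 2 + 3 * x 1 + 3 * x 0 + x 5"
    and "y 3 = x 3 + 3 * x 2 + 3 * x 1 + x 0"
    and "y 4 = x 4 + 3 * x 3 + 3 * x 2 + x 1"
    and "y 5 = x 5 + 3 * x 4 + 3 * x 3 + x 2"
proof -
  have rows: "m + 1 < 6 * N" "Suc m + 1 < 6 * N" "Suc (Suc m) + 1 < 6 * N"
    using assms(1) by auto
  have three: "m + 3 = Suc (Suc (Suc m))"
    by simp
  show "y 0 = x 0 + 3 * x 5 + 3 * x 4 + x 3"
    and "y 1 = x 1 + 3 * x 0 + 3 * x 5 + x 4"
    and "y 2 = x 2 + 3 * x 1 + 3 * x 0 + x 5"
    and "y 3 = x 3 + 3 * x 2 + 3 * x 1 + x 0"
    and "y 4 = x 4 + 3 * x 3 + 3 * x 2 + x 1"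
    and "y 5 = x 5 + 3 * x 4 + 3 * x 3 + x 2"
    unfolding x_def y_def three class_sum_step[OF rows(3)] class_sum_step[OF rows(2)]
      class_sum_step[OF rows(1)]
    by simp_all
qed

text \<open>Squaring the three-step map gives \<open>(1 + t)^6\<close>; its end coefficients 1 and 1
  fall together modulo \<open>t^6 - 1\<close>, whence the 2.\<close>

lemma class_sum_6_steps:
  assumes "m + 6 < 6 * N"
  defines "x \<equiv> class_sum N m" and "y \<equiv> class_sum N (m + 6)"
  shows "y 0 = 2 * x 0 + 6 * x 5 + 15 * x 4 + 20 * x 3 + 15 * x 2 + 6 * x 1"
    and "y 1 = 2 * x 1 + 6 * x 0 + 15 * x 5 + 20 * x 4 + 15 * x 3 + 6 * x 2"
    and "y 2 = 2 * x 2 + 6 * x 1 + 15 * x 0 + 20 * x 5 + 15 * x 4 + 6 * x 3"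
    and "y 3 = 2 * x 3 + 6 * x 2 + 15 * x 1 + 20 * x 0 + 15 * x 5 + 6 * x 4"
    and "y 4 = 2 * x 4 + 6 * x 3 + 15 * x 2 + 20 * x 1 + 15 * x 0 + 6 * x 5"
    and "y 5 = 2 * x 5 + 6 * x 4 + 15 * x 3 + 20 * x 2 + 15 * x 1 + 6 * x 0"
proof -
  have rows: "m + 3 < 6 * N" "(m + 3) + 3 < 6 * N"
    using assms(1) by auto
  have six: "m + 6 = (m + 3) + 3"
    by simp
  show "y 0 = 2 * x 0 + 6 * x 5 + 15 * x 4 + 20 * x 3 + 15 * x 2 + 6 * x 1"
    and "y 1 = 2 * x 1 + 6 * x 0 + 15 * x 5 + 20 * x 4 + 15 * x 3 + 6 * x 2"
    and "y 2 = 2 * x 2 + 6 * x 1 + 15 * x 0 + 20 * x 5 + 15 * x 4 + 6 * x 3"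
    and "y 3 = 2 * x 3 + 6 * x 2 + 15 * x 1 + 20 * x 0 + 15 * x 5 + 6 * x 4"
    and "y 4 = 2 * x 4 + 6 * x 3 + 15 * x 2 + 20 * x 1 + 15 * x 0 + 6 * x 5"
    and "y 5 = 2 * x 5 + 6 * x 4 + 15 * x 3 + 20 * x 2 + 15 * x 1 + 6 * x 0"
    unfolding x_def y_def six class_sum_3_steps[OF rows(2)] class_sum_3_steps[OF rows(1)]
    by simp_all
qed

text \<open>The starting row matters: \<open>(1 + t)^6\<close> does not fix row 0. Modulo 7, for
  instance, Fermat makes it 1 at every nonzero \<open>t\<close> except -1, where it is 0; the factor
  \<open>(1 + t)^4\<close> removes that exception.\<close>

lemma class_sum_mod_42:
  assumes "j < N"
  defines "x \<equiv> class_sum N (6 * j + 4)"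
  shows "x 0 mod 42 = 1 \<and> x 1 mod 42 = 4 \<and> x 2 mod 42 = 6 \<and>
         x 3 mod 42 = 4 \<and> x 4 mod 42 = 1 \<and> x 5 mod 42 = 0"
  using assms(1) unfolding x_def
proof (induction j)
  case 0
  then have rows: "0 + 1 < 6 * N" "Suc 0 + 1 < 6 * N" "Suc (Suc 0) + 1 < 6 * N"
      "Suc (Suc (Suc 0)) + 1 < 6 * N" "N \<ge> 1"
    by auto
  have four: "6 * 0 + 4 = Suc (Suc (Suc (Suc 0)))"
    by simp
  show ?case
    unfolding four class_sum_step[OF rows(4)] class_sum_step[OF rows(3)]
      class_sum_step[OF rows(2)] class_sum_step[OF rows(1)] class_sum_row_0[OF rows(5)]
    by simp
next
  case (Suc j)
  define z where "z = class_sum N (6 * j + 4)"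
  have IH: "[z 0 = 1] (mod 42)" "[z 1 = 4] (mod 42)" "[z 2 = 6] (mod 42)"
      "[z 3 = 4] (mod 42)" "[z 4 = 1] (mod 42)" "[z 5 = 0] (mod 42)"
    using Suc by (simp_all add: z_def cong_def)
  \<comment> \<open>One reduction modulo 42 for generic entries covers all six residues, by rotating
    the arguments.\<close>
  have circulant: "(2 * a + 6 * b + 15 * c + 20 * d + 15 * e + 6 * f) mod 42 =
      (2 * a' + 6 * b' + 15 * c' + 20 * d' + 15 * e' + 6 * f') mod 42"
    if "[a = a'] (mod 42)" "[b = b'] (mod 42)" "[c = c'] (mod 42)"
      "[d = d'] (mod 42)" "[e = e'] (mod 42)" "[f = f'] (mod 42)" for a b c d e f a' b' c' d' e' f' :: nat
    unfolding cong_def[symmetric] by (intro cong_add cong_mult cong_refl that)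
  have "6 * Suc j + 4 = (6 * j + 4) + 6" "(6 * j + 4) + 6 < 6 * N"
    using Suc.prems by auto
  note steps = class_sum_6_steps[OF this(2), folded z_def this(1)]
  \<comment> \<open>\<open>IH(k)\<close> concerns \<open>z (k - 1)\<close>, so the index lists run
    down cyclically. The values obtained are row 10 folded modulo 6: 211, 130, 90, 130, 211, 252,
    congruent to 1, 4, 6, 4, 1, 0.\<close>
  show ?case
    unfolding steps circulant[OF IH(1,6,5,4,3,2)] circulant[OF IH(2,1,6,5,4,3)]
      circulant[OF IH(3,2,1,6,5,4)] circulant[OF IH(4,3,2,1,6,5)] circulant[OF IH(5,4,3,2,1,6)]
      circulant[OF IH(6,5,4,3,2,1)]
    by simp
qed

theorem theorem3:
  fixes n :: nat
  assumes "n \<ge> 1"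
  shows "[(\<Sum>i = 0..n - 1. (6 * n choose (6 * i + 1)) + (6 * n choose (6 * i + 5))
            + ((6 * n - 2) choose (6 * i + 1)) + ((6 * n - 2) choose (6 * i + 3)))
          = (6 choose 1) + (6 choose 5) + (4 choose 1) + (4 choose 3)] (mod 42)
       \<and> (6 choose 1) + (6 choose 5) + (4 choose 1) + (4 choose 3) = (20 :: nat)"
proof
  show twenty: "(6 choose 1) + (6 choose 5) + (4 choose 1) + (4 choose 3) = (20 :: nat)"
    by (simp add: eval_nat_numeral)
  define m where "m = 6 * n - 2"
  define x where "x = class_sum n m"
  have rows: "6 * n = Suc (Suc m)" "m + 1 < 6 * n" "m = 6 * (n - 1) + 4"
    using assms by (simp_all add: m_def)
  have x: "[x 0 = 1] (mod 42)" "[x 1 = 4] (mod 42)" "[x 3 = 4] (mod 42)"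
      "[x 4 = 1] (mod 42)" "[x 5 = 0] (mod 42)"
    using class_sum_mod_42[of "n - 1" n] assms by (simp_all add: x_def rows(3) cong_def)
  \<comment> \<open>The step into row \<open>6 * n\<close> violates the bound of
    \<open>class_sum_step\<close>: with cutoff \<open>n\<close>, class 0 would lose the term
    \<open>6 * n choose (6 * n)\<close>. Only classes 1 and 5 are needed, and
    \<open>class_sum_Suc_Suc\<close> gives them without a bound.\<close>
  have top: "class_sum n (6 * n) 1 = x 5 + 2 * x 0 + x 1"
    "class_sum n (6 * n) 5 = x 3 + 2 * x 4 + x 5"
    using class_sum_Suc_Suc[of n "Suc m" 0] class_sum_Suc_Suc[of n "Suc m" 4]
      class_sum_step[OF rows(2)]
    by (simp_all add: rows(1) x_def)
  have "{0..n - 1} = {..<n}"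
    using assms by auto
  then have "(\<Sum>i = 0..n - 1. (6 * n choose (6 * i + 1)) + (6 * n choose (6 * i + 5))
            + ((6 * n - 2) choose (6 * i + 1)) + ((6 * n - 2) choose (6 * i + 3)))
      = class_sum n (6 * n) 1 + class_sum n (6 * n) 5 + x 1 + x 3"
    by (simp only: class_sum_def sum.distrib x_def m_def)
  also have "\<dots> = (x 5 + 2 * x 0 + x 1) + (x 3 + 2 * x 4 + x 5) + x 1 + x 3"
    by (simp only: top)
  \<comment> \<open>The four groups become 6, 6, 4, 4, matching the four binomials on the right one
    by one.\<close>
  also have "[\<dots> = (0 + 2 * 1 + 4) + (4 + 2 * 1 + 0) + 4 + 4] (mod 42)"
    by (intro cong_add cong_mult cong_refl x)
  finally show "[(\<Sum>i = 0..n - 1. (6 * n choose (6 * i + 1)) + (6 * n choose (6 * i + 5))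
            + ((6 * n - 2) choose (6 * i + 1)) + ((6 * n - 2) choose (6 * i + 3)))
          = (6 choose 1) + (6 choose 5) + (4 choose 1) + (4 choose 3)] (mod 42)"
    unfolding twenty by simp
qed

end
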